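(* For integers $\ell,m,p$, let $\mathfrak a_{\ell,m,p}$ be the number of inversion sequences $\sigma\in\mathcal{I}_\ell(110,201)$ such that $\max(\sigma)=m$ and the value $m$ appears exactly once in $\sigma$, at position $p$. Then for all $n\geqslant 2$, $$|\mathcal{I}_n(110,201)|=\sum_{\ell=1}^{n}\sum_{m=0}^{\ell-1}\sum_{p=m+1}^{\ell}\mathfrak a_{\ell,m,p}.$$
   Context: For $n\in\mathbb N$, an inversion sequence of size $n$ is a sequence $\sigma=(\sigma_1,\dots,\sigma_n)\in\mathbb N^n$ with $\sigma_i<i$ for all $i$. An integer sequence contains a pattern $\rho$ (a finite integer sequence such as $110$ or $201$) if it has a subsequence order-isomorphic to $\rho$, and avoids $\rho$ otherwise. $\mathcal{I}_n(P)$ denotes the set of inversion sequences of size $n$ avoiding every pattern in the set $P$. $\max(\sigma)$ is the largest entry of $\sigma$. *)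

theory Defs
  imports Main "HOL-Library.Sublist"
begin

(* Sequences are lists. The mathematical indexing is 1-based, so the i-th entry
   of sigma is "sigma ! (i - 1)". *)

definition inversion_seq :: "nat \<Rightarrow> nat list \<Rightarrow> bool" where
  "inversion_seq n \<sigma> \<longleftrightarrow> length \<sigma> = n \<and> (\<forall>i\<in>{1..n}. \<sigma> ! (i - 1) < i)"

(* Over linear orders the condition on "<" for all ordered pairs (i, j) also forces
   equal entries to correspond to equal entries. *)
definition order_isomorphic :: "'a::linorder list \<Rightarrow> 'b::linorder list \<Rightarrow> bool" where
  "order_isomorphic xs ys \<longleftrightarrow> length xs = length ys \<and>
     (\<forall>i<length xs. \<forall>j<length xs. xs ! i < xs ! j \<longleftrightarrow> ys ! i < ys ! j)"

(* "subseq" is the library's relation for not necessarily contiguous subsequences. *)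
definition contains_pattern :: "'a::linorder list \<Rightarrow> 'b::linorder list \<Rightarrow> bool" where
  "contains_pattern \<sigma> \<rho> \<longleftrightarrow> (\<exists>\<tau>. subseq \<tau> \<sigma> \<and> order_isomorphic \<tau> \<rho>)"

definition avoiding_inversion_seqs :: "nat \<Rightarrow> int list set \<Rightarrow> nat list set" where
  "avoiding_inversion_seqs n P =
     {\<sigma>. inversion_seq n \<sigma> \<and> (\<forall>\<rho>\<in>P. \<not> contains_pattern \<sigma> \<rho>)}"

definition num_unique_max :: "nat \<Rightarrow> nat \<Rightarrow> nat \<Rightarrow> nat" where
  "num_unique_max l m p = card {\<sigma> \<in> avoiding_inversion_seqs l {[1, 1, 0], [2, 0, 1]}.
     Max (set \<sigma>) = m \<and> count_list \<sigma> m = 1 \<and> p \<in> {1..l} \<and> \<sigma> ! (p - 1) = m}"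

end

theory Submission imports Defs begin

text \<open>A 110-avoiding sequence whose maximum is repeated must end in that maximum, since a smaller
  last entry would complete a 110. Conversely, appending a copy of the maximum creates neither
  pattern, because both end in a non-maximal letter. Hence, for positive length, appending the
  maximum is a bijection from all avoiders of length \<open>n\<close> onto those of length \<open>n + 1\<close>
  with repeated maximum, so the number of avoiders grows by the number with unique maximum.\<close>

text \<open>Kept generic in \<open>P\<close>: the recurrence below needs only that 110 lies in
  \<open>P\<close> and that every pattern ends strictly below one of its entries.\<close>

definition unique_max_seqs :: "nat \<Rightarrow> int list set \<Rightarrow> nat list set" where
  "unique_max_seqs n P =
     {\<sigma> \<in> avoiding_inversion_seqs n P. count_list \<sigma> (Max (set \<sigma>)) = 1}"

lemma inversion_seq_iff: "inversion_seq n xs \<longleftrightarrow> length xs = n \<and> (\<forall>i<n. xs ! i \<le> i)"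
proof -
  have "(\<forall>i\<in>{1..n}. xs ! (i - 1) < i) \<longleftrightarrow> (\<forall>i<n. xs ! i < Suc i)"
    unfolding image_Suc_lessThan[symmetric] by auto
  then show ?thesis
    by (simp add: inversion_seq_def less_Suc_eq_le)
qed

lemma inversion_seq_snoc [simp]:
  "inversion_seq (Suc n) (xs @ [x]) \<longleftrightarrow> inversion_seq n xs \<and> x \<le> n"
  by (auto simp: inversion_seq_iff nth_append less_Suc_eq)

lemma inversion_seq_Max_less:
  assumes "inversion_seq n xs" "n > 0"
  shows "Max (set xs) < n"
  using assms by (subst Max_less_iff) (fastforce simp: inversion_seq_iff in_set_conv_nth)+

lemma finite_avoiding_inversion_seqs: "finite (avoiding_inversion_seqs n P)"
proof (rule finite_subset)
  show "avoiding_inversion_seqs n P \<subseteq> {xs. set xs \<subseteq> {..n} \<and> length xs = n}"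
    by (fastforce simp: avoiding_inversion_seqs_def inversion_seq_iff in_set_conv_nth)
qed (simp add: finite_lists_length_eq)

lemma contains_pattern_snoc:
  "contains_pattern xs \<rho> \<Longrightarrow> contains_pattern (xs @ [x]) \<rho>"
  by (auto simp: contains_pattern_def intro: subseq_rev_drop_many)

text \<open>An occurrence that uses the appended \<open>m\<close> has it as its last letter. That
  letter would have to lie strictly below another letter of the occurrence, yet no entry exceeds
  \<open>m\<close>.\<close>

lemma contains_pattern_snoc_ge_iff:
  assumes m: "\<forall>x\<in>set xs. x \<le> m" and i: "i < length \<rho>" "last \<rho> < \<rho> ! i"
  shows "contains_pattern (xs @ [m]) \<rho> \<longleftrightarrow> contains_pattern xs \<rho>"
proof
  assume "contains_pattern (xs @ [m]) \<rho>"
  then obtain \<tau> where \<tau>: "subseq \<tau> (xs @ [m])" and iso: "order_isomorphic \<tau> \<rho>"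
    by (auto simp: contains_pattern_def)
  have len: "length \<tau> = length \<rho>" using iso by (simp add: order_isomorphic_def)
  have "\<rho> ! (length \<rho> - 1) < \<rho> ! i" 
    using i by (cases "\<rho> = []") (simp_all add: last_conv_nth)
  then have less: "\<tau> ! (length \<tau> - 1) < \<tau> ! i"
    using iso i by (simp add: order_isomorphic_def)
  have "set \<tau> \<subseteq> set (xs @ [m])"
    using \<tau> set_nths_subset by (metis subseq_conv_nths)
  then have "\<tau> ! i \<in> set (xs @ [m])"
    using i(1) len by (metis nth_mem subsetD)
  then have "\<tau> ! i \<le> m" using m by auto
  moreover have "\<tau> \<noteq> []" using i len by auto
  ultimately have "last \<tau> < m" using less by (simp add: last_conv_nth)
  obtain us vs where "\<tau> = us @ vs" "subseq us xs" "subseq vs [m]"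
    using \<tau> by (rule subseq_appendE)
  \<comment> \<open>If \<open>vs\<close> were nonempty it would be \<open>[m]\<close>, making
    \<open>m\<close> the last letter of \<open>\<tau>\<close>. So \<open>vs\<close> is empty and
    \<open>\<tau>\<close> embeds in \<open>xs\<close> alone.\<close>
  with \<open>last \<tau> < m\<close> have "subseq \<tau> xs"
    by (cases vs) (auto simp: list_emb_Cons_iff2 split: if_splits)
  then show "contains_pattern xs \<rho>" using iso by (auto simp: contains_pattern_def)
qed (rule contains_pattern_snoc)

lemma avoiding_inversion_seqs_snocD:
  "xs @ [x] \<in> avoiding_inversion_seqs (Suc n) P \<Longrightarrow> xs \<in> avoiding_inversion_seqs n P"
  by (auto simp: avoiding_inversion_seqs_def dest: contains_pattern_snoc)

text \<open>Positive length makes \<open>Max (set xs)\<close> an actual entry, hence below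
  \<open>n\<close> and admissible at the new position; for the empty list it would be
  unspecified.\<close>

lemma snoc_Max_in_avoiding_inversion_seqs_iff:
  assumes "n > 0" and P: "\<forall>\<rho>\<in>P. \<exists>i<length \<rho>. last \<rho> < \<rho> ! i"
  shows "xs @ [Max (set xs)] \<in> avoiding_inversion_seqs (Suc n) P \<longleftrightarrow>
    xs \<in> avoiding_inversion_seqs n P"
proof
  assume xs: "xs \<in> avoiding_inversion_seqs n P"
  then have "Max (set xs) \<le> n"
    using inversion_seq_Max_less[of n xs] \<open>n > 0\<close> by (auto simp: avoiding_inversion_seqs_def)
  moreover have "\<not> contains_pattern (xs @ [Max (set xs)]) \<rho>" if "\<rho> \<in> P" for \<rho>
    using contains_pattern_snoc_ge_iff[of xs "Max (set xs)" _ \<rho>] P that xs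
    by (auto simp: avoiding_inversion_seqs_def)
  ultimately show "xs @ [Max (set xs)] \<in> avoiding_inversion_seqs (Suc n) P"
    using xs by (auto simp: avoiding_inversion_seqs_def)
qed (rule avoiding_inversion_seqs_snocD)

lemma subseq_replicate_count_list: "subseq (replicate (count_list xs x) x) xs"
  by (induction xs) auto

lemma contains_pattern_110:
  fixes x m :: nat
  assumes "x < m" "count_list xs m \<ge> 2"
  shows "contains_pattern (xs @ [x]) [1, 1, 0 :: int]"
proof -
  have "[m, m] = replicate 2 m" by (simp add: numeral_2_eq_2)
  also have "subseq \<dots> (replicate (count_list xs m) m)"
    \<comment> \<open>Writing the count as 2 plus a remainder splits \<open>replicate\<close> into
      two copies of \<open>m\<close> and the rest.\<close>
    by (subst le_add_diff_inverse[OF assms(2), symmetric], subst replicate_add)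
      (rule subseq_rev_drop_many, rule subseq_order.order_refl)
  also have "subseq \<dots> xs" by (rule subseq_replicate_count_list)
  finally have "subseq ([m, m] @ [x]) (xs @ [x])" by (rule list_emb_append_mono) simp
  moreover have "order_isomorphic [m, m, x] [1, 1, 0 :: int]"
    using assms(1) by (simp add: order_isomorphic_def All_less_Suc)
  ultimately show ?thesis by (auto simp: contains_pattern_def)
qed

text \<open>The inverse map deletes the last entry. Avoiding 110 forces that entry to equal the
  repeated maximum, and another copy stays behind, so the prefix has the same maximum.\<close>

lemma repeated_max_eq_image:
  assumes "n > 0" and P: "\<forall>\<rho>\<in>P. \<exists>i<length \<rho>. last \<rho> < \<rho> ! i" and "[1, 1, 0] \<in> P"
  shows "avoiding_inversion_seqs (Suc n) P - unique_max_seqs (Suc n) P =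
    (\<lambda>xs. xs @ [Max (set xs)]) ` avoiding_inversion_seqs n P" (is "?L = ?R")
proof (intro equalityI subsetI)
  fix \<sigma> assume "\<sigma> \<in> ?L"
  then have \<sigma>: "\<sigma> \<in> avoiding_inversion_seqs (Suc n) P"
    and ne1: "count_list \<sigma> (Max (set \<sigma>)) \<noteq> 1"
    by (auto simp: unique_max_seqs_def)
  from \<sigma> obtain xs x where xs: "\<sigma> = xs @ [x]"
    by (cases \<sigma> rule: rev_cases) (auto simp: avoiding_inversion_seqs_def inversion_seq_def)
  define m where "m = Max (set \<sigma>)"
  have "m \<in> set \<sigma>" unfolding m_def by (rule Max_in) (auto simp: xs)
  then have "count_list \<sigma> m \<noteq> 0" by (simp add: count_list_0_iff)
  \<comment> \<open>A maximum is attained, so a multiplicity other than 1 is at least 2.\<close>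
  with ne1 have ge2: "count_list \<sigma> m \<ge> 2" by (simp add: m_def)
  have "x \<le> m" by (simp add: m_def xs)
  moreover have "\<not> x < m"
    using contains_pattern_110[of x m xs] ge2 \<sigma> \<open>[1, 1, 0] \<in> P\<close>
    by (auto simp: xs avoiding_inversion_seqs_def)
  ultimately have "x = m" by simp
  then have "count_list xs m \<noteq> 0" using ge2 xs by simp
  then have "m \<in> set xs" by (simp add: count_list_0_iff)
  moreover have "y \<le> m" if "y \<in> set xs" for y using that by (simp add: m_def xs)
  ultimately have "Max (set xs) = m" by (intro Max_eqI) auto
  then show "\<sigma> \<in> ?R"
    using \<sigma> xs \<open>x = m\<close> avoiding_inversion_seqs_snocD by blast
next
  fix \<sigma> assume "\<sigma> \<in> ?R"
  then obtain xs where xs: "xs \<in> avoiding_inversion_seqs n P" "\<sigma> = xs @ [Max (set xs)]"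
    by blast
  then have "xs \<noteq> []" using \<open>n > 0\<close> by (auto simp: avoiding_inversion_seqs_def inversion_seq_def)
  \<comment> \<open>The prefix already attains its maximum, so the appended copy is at least the
    second one.\<close>
  then have "count_list xs (Max (set xs)) \<noteq> 0" by (simp add: count_list_0_iff)
  moreover have "Max (set \<sigma>) = Max (set xs)" using \<open>xs \<noteq> []\<close> by (simp add: xs)
  ultimately have "\<sigma> \<notin> unique_max_seqs (Suc n) P" by (simp add: unique_max_seqs_def xs)
  then show "\<sigma> \<in> ?L"
    using xs snoc_Max_in_avoiding_inversion_seqs_iff[OF \<open>n > 0\<close> P] by simp
qed

text \<open>Splits the avoiders by whether the maximum is repeated; appending the maximum is
  injective because the prefix can be read off the result.\<close>

lemma card_avoiding_inversion_seqs_Suc: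
  assumes "n > 0" "\<forall>\<rho>\<in>P. \<exists>i<length \<rho>. last \<rho> < \<rho> ! i" "[1, 1, 0] \<in> P"
  shows "card (avoiding_inversion_seqs (Suc n) P) =
    card (avoiding_inversion_seqs n P) + card (unique_max_seqs (Suc n) P)"
proof -
  let ?A = "avoiding_inversion_seqs (Suc n) P" and ?U = "unique_max_seqs (Suc n) P"
  have sub: "?U \<subseteq> ?A" by (auto simp: unique_max_seqs_def)
  have "card (?A - ?U) = card (avoiding_inversion_seqs n P)"
    unfolding repeated_max_eq_image[OF assms] by (rule card_image) (auto simp: inj_on_def)
  moreover have "card (?A - ?U) = card ?A - card ?U"
    using sub finite_subset[OF sub finite_avoiding_inversion_seqs] by (simp add: card_Diff_subset)
  moreover have "card ?U \<le> card ?A"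
    by (rule card_mono[OF finite_avoiding_inversion_seqs sub])
  ultimately show ?thesis by simp
qed

lemma count_list_1_nth_unique:
  assumes "count_list xs x = 1" "i < length xs" "j < length xs" "xs ! i = x" "xs ! j = x"
  shows "i = j"
proof -
  have "card {i. i < length xs \<and> x = xs ! i} = 1"
    using assms(1) by (simp add: count_list_eq_length_filter length_filter_conv_card)
  then obtain k where "{i. i < length xs \<and> x = xs ! i} = {k}"
    by (rule card_1_singletonE)
  moreover have "i \<in> {i. i < length xs \<and> x = xs ! i}" "j \<in> {i. i < length xs \<and> x = xs ! i}"
    using assms(2-) by auto
  ultimately show ?thesis by simp
qed

text \<open>Sorting the sequences by the value and the position of their unique maximum gives
  disjoint classes. The ranges of \<open>m\<close> and \<open>p\<close> lose nothing, since a value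
  \<open>m\<close> at 1-based position \<open>p\<close> satisfies \<open>m < p\<close>.\<close>

lemma sum_num_unique_max:
  assumes "l > 0"
  shows "(\<Sum>m = 0..l - 1. \<Sum>p = m + 1..l. num_unique_max l m p) =
    card (unique_max_seqs l {[1, 1, 0], [2, 0, 1]})"
proof -
  let ?P = "{[1, 1, 0], [2, 0, 1]} :: int list set"
  define S where "S = (\<lambda>(m, p). {\<sigma> \<in> avoiding_inversion_seqs l ?P.
     Max (set \<sigma>) = m \<and> count_list \<sigma> m = 1 \<and> p \<in> {1..l} \<and> \<sigma> ! (p - 1) = m})"
  define I where "I = (SIGMA m:{0..l - 1}. {m + 1..l})"
  have num_eq: "num_unique_max l m p = card (S (m, p))" for m p
    by (simp add: S_def num_unique_max_def)
  have len: "length \<sigma> = l" if "\<sigma> \<in> S x" for \<sigma> x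
    using that by (auto simp: S_def avoiding_inversion_seqs_def inversion_seq_def)
  have disj: "S x \<inter> S y = {}" if "x \<noteq> y" for x y
  proof (rule ccontr)
    assume "S x \<inter> S y \<noteq> {}"
    then obtain \<sigma> where \<sigma>: "\<sigma> \<in> S x" "\<sigma> \<in> S y" by blast
    obtain m p where x: "x = (m, p)" by (rule prod.exhaust)
    obtain m' q where y: "y = (m', q)" by (rule prod.exhaust)
    have "m = m'" using \<sigma> by (simp add: S_def x y)
    have "p - 1 = q - 1"
      by (rule count_list_1_nth_unique[of \<sigma> m])
        (use \<sigma> len[OF \<sigma>(1)] in \<open>auto simp: S_def x y \<open>m = m'\<close>\<close>)
    \<comment> \<open>Subtraction on naturals truncates, so positivity is needed to pass from
      \<open>p - 1 = q - 1\<close> to \<open>p = q\<close>.\<close>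
    moreover have "p \<ge> 1" "q \<ge> 1" using \<sigma> by (simp_all add: S_def x y)
    ultimately show False using that x y \<open>m = m'\<close> by simp
  qed
  have "(\<Sum>m = 0..l - 1. \<Sum>p = m + 1..l. num_unique_max l m p) = (\<Sum>x\<in>I. card (S x))"
    by (simp add: num_eq sum.Sigma I_def)
  also have "\<dots> = card (\<Union>x\<in>I. S x)"
    using disj by (intro card_UN_disjoint[symmetric])
      (auto simp: I_def S_def intro: finite_subset[OF _ finite_avoiding_inversion_seqs])
  also have "(\<Union>x\<in>I. S x) = unique_max_seqs l ?P"
  proof (intro equalityI subsetI)
    fix \<sigma> assume "\<sigma> \<in> unique_max_seqs l ?P"
    then have \<sigma>: "\<sigma> \<in> avoiding_inversion_seqs l ?P" "count_list \<sigma> (Max (set \<sigma>)) = 1"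
      and inv: "inversion_seq l \<sigma>"
      by (auto simp: unique_max_seqs_def avoiding_inversion_seqs_def)
    have "Max (set \<sigma>) \<in> set \<sigma>" using inv assms by (intro Max_in) (auto simp: inversion_seq_def)
    then obtain i where i: "i < l" "\<sigma> ! i = Max (set \<sigma>)"
      using inv by (auto simp: in_set_conv_nth inversion_seq_def)
    then have "Max (set \<sigma>) \<le> i" using inv by (metis inversion_seq_iff)
    \<comment> \<open>The list index \<open>i\<close> is the 1-based position \<open>Suc i\<close>,
      so the bound by \<open>i\<close> becomes the lower limit \<open>m + 1\<close> for
      \<open>p\<close>.\<close>
    then have "(Max (set \<sigma>), Suc i) \<in> I" using i by (auto simp: I_def)
    moreover have "\<sigma> \<in> S (Max (set \<sigma>), Suc i)" using i \<sigma> by (simp add: S_def)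
    ultimately show "\<sigma> \<in> (\<Union>x\<in>I. S x)" by blast
  qed (auto simp: S_def unique_max_seqs_def)
  finally show ?thesis .
qed

text \<open>The only inversion sequence of size 1 is \<open>[0]\<close>, whose maximum occurs once.
  This starts the induction, as the recurrence requires positive length.\<close>

lemma avoiding_inversion_seqs_1_eq_unique_max_seqs:
  "avoiding_inversion_seqs 1 P = unique_max_seqs 1 P"
  by (auto simp: unique_max_seqs_def avoiding_inversion_seqs_def inversion_seq_def length_Suc_conv)

theorem theorem8:
  fixes n :: nat
  assumes "n \<ge> 2"
  shows "card (avoiding_inversion_seqs n {[1, 1, 0], [2, 0, 1]}) =
    (\<Sum>l = 1..n. \<Sum>m = 0..l - 1. \<Sum>p = m + 1..l. num_unique_max l m p)"
proof -
  let ?P = "{[1, 1, 0], [2, 0, 1]} :: int list set"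
  \<comment> \<open>Index 0 serves for both patterns: 110 and 201 each begin with a letter larger
    than their last.\<close>
  have P: "\<forall>\<rho>\<in>?P. \<exists>i<length \<rho>. last \<rho> < \<rho> ! i"
    by (auto intro!: exI[of _ 0])
  have "n \<ge> 1" using assms by simp
  \<comment> \<open>Iterating the recurrence down to length 1 telescopes into a sum over all
    lengths.\<close>
  then have "card (avoiding_inversion_seqs n ?P) = (\<Sum>l = 1..n. card (unique_max_seqs l ?P))"
  proof (induction n rule: dec_induct)
    case base
    show ?case by (simp add: avoiding_inversion_seqs_1_eq_unique_max_seqs[unfolded One_nat_def])
  next
    case (step n)
    then show ?case using card_avoiding_inversion_seqs_Suc[OF _ P, of n] by simp
  qed
  also have "\<dots> = (\<Sum>l = 1..n. \<Sum>m = 0..l - 1. \<Sum>p = m + 1..l. num_unique_max l m p)"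
    by (intro sum.cong sum_num_unique_max[symmetric]) auto
  finally show ?thesis .
qed

end
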